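(* Polytree Learning with component size bound $q$ (PT$_{\mathrm{comp}}$) admits a polynomial-time $2q$-approximation algorithm: an algorithm running in polynomial time that outputs a polytree $D$ each of whose connected components has at most $q$ arcs and such that $f(D)\le f(D^{\mathrm{opt}})\le 2q\, f(D)$, where $D^{\mathrm{opt}}$ is a maximum-score polytree each of whose connected components has at most $q$ arcs.
   Context: A DAG $D=(V,A)$ is a polytree if its skeleton is a forest; connected components are those of the skeleton; $D_v$ is the parent set of $v$. Input: node set $V$, integer $q$, and for each $v\in V$ a family $\mathcal{F}_v$ of potential parent sets with real scores $f_v(S)$ for $S\in\mathcal{F}_v$ (non-zero encoding: $f_v(S)=-\infty$ for $S\notin\mathcal{F}_v$; $\emptyset\in\mathcal{F}_v$ with $f_v(\emptyset)=0$). The score of $D$ is $f(D)=\sum_v f_v(D_v)$. In PT$_{\mathrm{comp}}$ the goal is a maximum-score polytree in which every connected component has at most $q$ arcs. *)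

theory Defs
  imports "HOL-Library.Extended_Real" "HOL-Computational_Algebra.Polynomial"
begin

section \<open>Polytrees and their scores\<close>

text \<open>A digraph is given by a node set \<open>V\<close> and an arc set \<open>A\<close>; the arc \<open>(u, v)\<close> points from
  \<open>u\<close> to \<open>v\<close>.\<close>

definition dag :: "'a set \<Rightarrow> ('a \<times> 'a) set \<Rightarrow> bool" where
  "dag V A \<longleftrightarrow> finite V \<and> A \<subseteq> V \<times> V \<and> acyclic A"

definition skeleton :: "('a \<times> 'a) set \<Rightarrow> 'a set set" where
  "skeleton A = {{u, v} | u v. (u, v) \<in> A}"

definition cycle_in :: "'a set set \<Rightarrow> 'a list \<Rightarrow> bool" where
  "cycle_in E xs \<longleftrightarrow> 3 \<le> length xs \<and> distinct xs \<and>
     (\<forall>i < length xs. {xs ! i, xs ! (Suc i mod length xs)} \<in> E)"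

definition forest :: "'a set set \<Rightarrow> bool" where
  "forest E \<longleftrightarrow> (\<nexists>xs. cycle_in E xs)"

definition polytree :: "'a set \<Rightarrow> ('a \<times> 'a) set \<Rightarrow> bool" where
  "polytree V A \<longleftrightarrow> dag V A \<and> forest (skeleton A)"

definition components :: "'a set \<Rightarrow> 'a set set \<Rightarrow> 'a set set" where
  "components V E = {{w \<in> V. (v, w) \<in> {(x, y). {x, y} \<in> E}\<^sup>*} | v. v \<in> V}"

definition component_bounded :: "'a set \<Rightarrow> nat \<Rightarrow> ('a \<times> 'a) set \<Rightarrow> bool" where
  "component_bounded V q A \<longleftrightarrow>
     (\<forall>C \<in> components V (skeleton A). card (A \<inter> C \<times> C) \<le> q)"

definition parents :: "('a \<times> 'a) set \<Rightarrow> 'a \<Rightarrow> 'a set" where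
  "parents A v = {u. (u, v) \<in> A}"

definition local_score :: "('a \<Rightarrow> 'a set set) \<Rightarrow> ('a \<Rightarrow> 'a set \<Rightarrow> real) \<Rightarrow> 'a \<Rightarrow> 'a set \<Rightarrow> ereal" where
  "local_score F f v S = (if S \<in> F v then ereal (f v S) else -\<infinity>)"

definition score ::
  "'a set \<Rightarrow> ('a \<Rightarrow> 'a set set) \<Rightarrow> ('a \<Rightarrow> 'a set \<Rightarrow> real) \<Rightarrow> ('a \<times> 'a) set \<Rightarrow> ereal" where
  "score V F f A = (\<Sum>v\<in>V. local_score F f v (parents A v))"

definition pt_instance :: "'a set \<Rightarrow> ('a \<Rightarrow> 'a set set) \<Rightarrow> ('a \<Rightarrow> 'a set \<Rightarrow> real) \<Rightarrow> bool" where
  "pt_instance V F f \<longleftrightarrow> finite V \<and>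
     (\<forall>v\<in>V. F v \<subseteq> Pow (V - {v}) \<and> {} \<in> F v \<and> f v {} = 0)"

definition pt_comp_feasible :: "'a set \<Rightarrow> nat \<Rightarrow> ('a \<times> 'a) set \<Rightarrow> bool" where
  "pt_comp_feasible V q A \<longleftrightarrow> polytree V A \<and> component_bounded V q A"

definition pt_comp_optimal ::
  "'a set \<Rightarrow> nat \<Rightarrow> ('a \<Rightarrow> 'a set set) \<Rightarrow> ('a \<Rightarrow> 'a set \<Rightarrow> real) \<Rightarrow> ('a \<times> 'a) set \<Rightarrow> bool" where
  "pt_comp_optimal V q F f A \<longleftrightarrow> pt_comp_feasible V q A \<and>
     (\<forall>B. pt_comp_feasible V q B \<longrightarrow> score V F f B \<le> score V F f A)"

lemma pt_comp_optimal_exists: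
  assumes "finite V"
  shows "\<exists>A. pt_comp_optimal V q F f A"
proof -
  let ?X = "{A. pt_comp_feasible V q A}"
  have "?X \<subseteq> Pow (V \<times> V)"
    by (auto simp: pt_comp_feasible_def polytree_def dag_def)
  then have fin: "finite ?X"
    using assms by (meson finite_Pow_iff finite_SigmaI finite_subset)
  have "forest (skeleton ({} :: ('a \<times> 'a) set))"
    unfolding forest_def cycle_in_def skeleton_def by fastforce
  then have "{} \<in> ?X"
    using assms by (simp add: pt_comp_feasible_def polytree_def dag_def component_bounded_def
        acyclic_def)
  then have ne: "?X \<noteq> {}" by blast
  have "Max (score V F f ` ?X) \<in> score V F f ` ?X"
    using fin ne by (intro Max_in) auto
  then obtain A where A: "A \<in> ?X" "score V F f A = Max (score V F f ` ?X)"
    by (metis imageE)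
  have "score V F f B \<le> score V F f A" if "B \<in> ?X" for B
    unfolding A(2) using fin that by (intro Max_ge) auto
  with A(1) show ?thesis
    unfolding pt_comp_optimal_def by blast
qed


section \<open>Random access machine\<close>

text \<open>
  Real scores are handled by a random access machine with two kinds of cells, natural numbers and
  real numbers, programmed in a structured language. Memory consists of arrays
  (named by numbers); a scalar variable is a cell of an array at a constant index.
  Real cells can only be added, subtracted and compared.

  Each assignment and each test costs one time unit. This is a reasonable unit cost measure:
  the program is fixed, so an expression stands for constantly many elementary operations, and
  without multiplication the bit length of a number grows by at most a constant per time unit,
  so that on rational scores a polynomial number of time units is polynomial time on a Turing
  machine. Real constants other than zero are excluded because they could encode arbitrary
  information in a program.
\<close>

datatype aexp = Num nat | Cell nat aexp | Add aexp aexp | Sub aexp aexp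

datatype rexp = RZero | RCell nat aexp | RAdd rexp rexp | RSub rexp rexp

datatype bexp = Less aexp aexp | RLess rexp rexp | BNot bexp | BAnd bexp bexp

datatype com =
    Skip
  | Store nat aexp aexp
  | RStore nat aexp rexp
  | Seq com com
  | Cond bexp com com
  | While bexp com

type_synonym state = "(nat \<Rightarrow> nat \<Rightarrow> nat) \<times> (nat \<Rightarrow> nat \<Rightarrow> real)"

fun aval :: "aexp \<Rightarrow> state \<Rightarrow> nat" where
  "aval (Num n) s = n"
| "aval (Cell a e) s = fst s a (aval e s)"
| "aval (Add e1 e2) s = aval e1 s + aval e2 s"
| "aval (Sub e1 e2) s = aval e1 s - aval e2 s"

fun rval :: "rexp \<Rightarrow> state \<Rightarrow> real" where
  "rval RZero s = 0"
| "rval (RCell a e) s = snd s a (aval e s)"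
| "rval (RAdd e1 e2) s = rval e1 s + rval e2 s"
| "rval (RSub e1 e2) s = rval e1 s - rval e2 s"

fun bval :: "bexp \<Rightarrow> state \<Rightarrow> bool" where
  "bval (Less e1 e2) s \<longleftrightarrow> aval e1 s < aval e2 s"
| "bval (RLess e1 e2) s \<longleftrightarrow> rval e1 s < rval e2 s"
| "bval (BNot b) s \<longleftrightarrow> \<not> bval b s"
| "bval (BAnd b1 b2) s \<longleftrightarrow> bval b1 s \<and> bval b2 s"

definition upd :: "(nat \<Rightarrow> nat \<Rightarrow> 'b) \<Rightarrow> nat \<Rightarrow> nat \<Rightarrow> 'b \<Rightarrow> nat \<Rightarrow> nat \<Rightarrow> 'b" where
  "upd m a i x = m(a := (m a)(i := x))"

text \<open>\<open>exec c s t s'\<close>: started in \<open>s\<close>, the program \<open>c\<close> halts in \<open>s'\<close> after \<open>t\<close> time units.\<close>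

inductive exec :: "com \<Rightarrow> state \<Rightarrow> nat \<Rightarrow> state \<Rightarrow> bool" where
  Skip: "exec Skip s 1 s"
| Store: "exec (Store a i e) s 1 (upd (fst s) a (aval i s) (aval e s), snd s)"
| RStore: "exec (RStore a i e) s 1 (fst s, upd (snd s) a (aval i s) (rval e s))"
| Seq: "exec c1 s1 t1 s2 \<Longrightarrow> exec c2 s2 t2 s3 \<Longrightarrow> exec (Seq c1 c2) s1 (t1 + t2) s3"
| CondTrue: "bval b s \<Longrightarrow> exec c1 s t s' \<Longrightarrow> exec (Cond b c1 c2) s (1 + t) s'"
| CondFalse: "\<not> bval b s \<Longrightarrow> exec c2 s t s' \<Longrightarrow> exec (Cond b c1 c2) s (1 + t) s'"
| WhileFalse: "\<not> bval b s \<Longrightarrow> exec (While b c) s 1 s"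
| WhileTrue: "bval b s1 \<Longrightarrow> exec c s1 t1 s2 \<Longrightarrow> exec (While b c) s2 t2 s3 \<Longrightarrow>
    exec (While b c) s1 (1 + t1 + t2) s3"

inductive_cases SkipE: "exec Skip s t s'"
inductive_cases StoreE: "exec (Store a i e) s t s'"
inductive_cases RStoreE: "exec (RStore a i e) s t s'"
inductive_cases SeqE: "exec (Seq c1 c2) s t s'"
inductive_cases CondE: "exec (Cond b c1 c2) s t s'"
inductive_cases WhileE: "exec (While b c) s t s'"

lemma exec_deterministic:
  "exec c s t s' \<Longrightarrow> exec c s u s'' \<Longrightarrow> t = u \<and> s' = s''"
proof (induction arbitrary: u s'' rule: exec.induct)
  case (Skip s)
  then show ?case by (rule SkipE) simp
next
  case (Store a i e s)
  then show ?case by (rule StoreE) simp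
next
  case (RStore a i e s)
  then show ?case by (rule RStoreE) simp
next
  case (Seq c1 s1 t1 s2 c2 t2 s3)
  from Seq.prems obtain u1 u2 r where r: "exec c1 s1 u1 r" "exec c2 r u2 s''" "u = u1 + u2"
    by (rule SeqE)
  from Seq.IH(1)[OF r(1)] Seq.IH(2)[of u2 s''] r show ?case by simp
next
  case (CondTrue b s c1 t s' c2)
  from CondTrue.prems CondTrue.hyps(1) obtain u' where r: "exec c1 s u' s''" "u = 1 + u'"
    by (elim CondE) simp_all
  from CondTrue.IH[OF r(1)] r(2) show ?case by simp
next
  case (CondFalse b s c2 t s' c1)
  from CondFalse.prems CondFalse.hyps(1) obtain u' where r: "exec c2 s u' s''" "u = 1 + u'"
    by (elim CondE) simp_all
  from CondFalse.IH[OF r(1)] r(2) show ?case by simp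
next
  case (WhileFalse b s c)
  from WhileFalse.prems show ?case by (rule WhileE) (use WhileFalse.hyps in simp_all)
next
  case (WhileTrue b s1 c t1 s2 t2 s3)
  from WhileTrue.prems obtain u1 u2 r
    where r: "exec c s1 u1 r" "exec (While b c) r u2 s''" "u = 1 + u1 + u2"
    by (rule WhileE) (use WhileTrue.hyps(1) in auto)
  from WhileTrue.IH(1)[OF r(1)] WhileTrue.IH(2)[of u2 s''] r show ?case by simp
qed


section \<open>Input and output conventions\<close>

text \<open>
  An instance is presented by a list of its nodes and a list of entries \<open>(v, ps, x)\<close>, one for
  each pair of a node \<open>v\<close> and a potential parent set (listed by \<open>ps\<close>) of \<open>v\<close>, where \<open>x\<close> is its
  score. Lists are written preceded by their length.
\<close>

definition presents ::
  "nat list \<Rightarrow> (nat \<times> nat list \<times> real) list \<Rightarrow>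
   nat set \<Rightarrow> (nat \<Rightarrow> nat set set) \<Rightarrow> (nat \<Rightarrow> nat set \<Rightarrow> real) \<Rightarrow> bool" where
  "presents vs es V F f \<longleftrightarrow>
     distinct vs \<and> set vs = V \<and>
     distinct (map (\<lambda>(v, ps, x). (v, set ps)) es) \<and>
     set (map (\<lambda>(v, ps, x). (v, set ps)) es) = Sigma V F \<and>
     (\<forall>(v, ps, x) \<in> set es. distinct ps \<and> x = f v (set ps))"

definition nat_input :: "nat \<Rightarrow> nat list \<Rightarrow> (nat \<times> nat list \<times> real) list \<Rightarrow> nat list" where
  "nat_input q vs es =
     [q, length vs] @ vs @ [length es] @ concat (map (\<lambda>(v, ps, x). [v, length ps] @ ps) es)"

definition real_input :: "(nat \<times> nat list \<times> real) list \<Rightarrow> real list" where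
  "real_input es = map (\<lambda>(v, ps, x). x) es"

definition input_size :: "nat \<Rightarrow> nat list \<Rightarrow> (nat \<times> nat list \<times> real) list \<Rightarrow> nat" where
  "input_size q vs es = length (nat_input q vs es) + length (real_input es)"

text \<open>The input is placed in the arrays with name 0; all other cells are zero.\<close>

definition initial_state :: "nat \<Rightarrow> nat list \<Rightarrow> (nat \<times> nat list \<times> real) list \<Rightarrow> state" where
  "initial_state q vs es =
     ((\<lambda>a i. if a = 0 \<and> i < length (nat_input q vs es) then nat_input q vs es ! i else 0),
      (\<lambda>a i. if a = 0 \<and> i < length (real_input es) then real_input es ! i else 0))"

text \<open>The output is the arc list in the natural number array with name 1: the number of arcs,
  followed by the tail and the head of each arc.\<close>

definition output_arcs :: "state \<Rightarrow> (nat \<times> nat) set" where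
  "output_arcs s = {(fst s 1 (2 * i + 1), fst s 1 (2 * i + 2)) | i. i < fst s 1 0}"

end

theory Submission
  imports Defs
begin

text \<open>
  Call \<open>f v S / |S|\<close> the density of a nonempty parent set \<open>S\<close> of \<open>v\<close>. The algorithm repeatedly picks
  a densest pair \<open>(v, S)\<close> with \<open>0 < |S| \<le> q\<close> and positive score such that \<open>insert v S\<close> avoids all
  nodes used so far. The picks are node-disjoint stars with at most \<open>q\<close> arcs, hence feasible. Every
  pair of positive score in an optimal solution shares a node with a pick of at least its density.
  A pick with \<open>s\<close> parents has \<open>s + 1\<close> nodes, so it meets at most \<open>s + 1\<close> components of the optimal
  solution, which have at most \<open>q\<close> arcs each. The pairs charged to it therefore have total score at
  most its density times \<open>(s + 1) * q \<le> 2 * s * q\<close>, which is \<open>2 * q\<close> times its own score.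

  The machine cannot divide, so it compares densities by cross multiplication, done by repeated
  addition.
\<close>

section \<open>Packings of stars\<close>

text \<open>Arcs run from the leaves to the centre, so each star realises one parent set. The index
  type is kept separate from the nodes because the program will index stars by entry
  positions.\<close>

definition stars :: "'i set \<Rightarrow> ('i \<Rightarrow> 'a) \<Rightarrow> ('i \<Rightarrow> 'a set) \<Rightarrow> ('a \<times> 'a) set" where
  "stars I c S = (\<Union>i\<in>I. S i \<times> {c i})"

locale star_packing =
  fixes V :: "'a set" and I :: "'i set" and c :: "'i \<Rightarrow> 'a" and S :: "'i \<Rightarrow> 'a set"
  assumes fin: "finite V"
    and sub: "i \<in> I \<Longrightarrow> insert (c i) (S i) \<subseteq> V"
    and c_notin: "i \<in> I \<Longrightarrow> c i \<notin> S i"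
    and disj: "i \<in> I \<Longrightarrow> j \<in> I \<Longrightarrow> i \<noteq> j \<Longrightarrow> insert (c i) (S i) \<inter> insert (c j) (S j) = {}"
begin

lemma same_star:
  "i \<in> I \<Longrightarrow> j \<in> I \<Longrightarrow> x \<in> insert (c i) (S i) \<Longrightarrow> x \<in> insert (c j) (S j) \<Longrightarrow> i = j"
  using disj by blast

lemma parents_stars_centre:
  assumes "i \<in> I"
  shows "parents (stars I c S) (c i) = S i"
proof -
  have "j = i" if "j \<in> I" "c j = c i" for j
    using same_star[of i j "c i"] assms that by auto
  then show ?thesis
    using assms by (auto simp: parents_def stars_def)
qed

lemma parents_stars_other: "v \<notin> c ` I \<Longrightarrow> parents (stars I c S) v = {}"
  by (auto simp: parents_def stars_def)

lemma inj_centre: "inj_on c I"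
  by (rule inj_onI) (metis same_star insertI1)

text \<open>Disjointness puts a leaf into a single star, where its only edge goes to the centre. So
  leaves have degree one.\<close>

lemma leaf_neighbour:
  assumes "i \<in> I" "u \<in> S i" "{u, w} \<in> skeleton (stars I c S)"
  shows "w = c i"
proof -
  obtain j a where j: "j \<in> I" "a \<in> S j" "{u, w} = {a, c j}"
    using assms(3) by (auto simp: skeleton_def stars_def)
  have "u \<in> insert (c j) (S j)" using j by auto
  then have "j = i" using same_star[of j i u] j(1) assms by auto
  with j assms c_notin[OF assms(1)] show ?thesis by (auto simp: doubleton_eq_iff)
qed

lemma edge_cases:
  assumes "{u, w} \<in> skeleton (stars I c S)"
  obtains i where "i \<in> I" "u \<in> S i" "w = c i" | i where "i \<in> I" "w \<in> S i" "u = c i"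
  using assms by (auto simp: skeleton_def stars_def doubleton_eq_iff)

text \<open>Each edge has a leaf as one end, but on a cycle that leaf would have two distinct
  neighbours.\<close>

lemma forest_stars: "forest (skeleton (stars I c S))"
  unfolding forest_def
proof
  assume "\<exists>xs. cycle_in (skeleton (stars I c S)) xs"
  then obtain xs where len: "3 \<le> length xs" and dist: "distinct xs"
    and edge: "\<And>i. i < length xs \<Longrightarrow> {xs ! i, xs ! (Suc i mod length xs)} \<in> skeleton (stars I c S)"
    unfolding cycle_in_def by blast
  have "2 mod length xs = 2" "0 < length xs" using len by auto
  with edge[of 0] edge[of 1] have e01: "{xs ! 0, xs ! 1} \<in> skeleton (stars I c S)"
    and e12: "{xs ! 1, xs ! 2} \<in> skeleton (stars I c S)"
    using len by (auto simp: numeral_2_eq_2)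
  have eL: "{xs ! 0, xs ! (length xs - 1)} \<in> skeleton (stars I c S)"
  proof -
    have "Suc (length xs - 1) = length xs" using len by simp
    with edge[of "length xs - 1"] len show ?thesis by (simp add: insert_commute)
  qed
  \<comment> \<open>If \<open>xs ! 0\<close> is the leaf, its neighbours \<open>xs ! 1\<close> and
    the last node coincide; if \<open>xs ! 1\<close> is, its neighbours \<open>xs ! 0\<close> and
    \<open>xs ! 2\<close> do.\<close>
  from e01 show False
  proof (cases rule: edge_cases)
    case (1 i)
    then have "xs ! (length xs - 1) = xs ! 1"
      using leaf_neighbour[OF _ _ eL] by auto
    then show False using dist len by (auto simp: nth_eq_iff_index_eq)
  next
    case (2 i)
    then have "xs ! 2 = xs ! 0"
      using leaf_neighbour[OF _ _ e12] by auto
    moreover have "(2 :: nat) < length xs" "0 < length xs" using len by auto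
    ultimately show False using dist nth_eq_iff_index_eq[of xs 2 0] by simp
  qed
qed

lemma acyclic_stars: "acyclic (stars I c S)"
proof -
  \<comment> \<open>No two arcs can be composed: the middle node would be a centre and a leaf. So
    the relation is vacuously transitive.\<close>
  have "(stars I c S)\<^sup>+ = stars I c S"
  proof (rule trancl_id, rule transI)
    fix x y z assume "(x, y) \<in> stars I c S" "(y, z) \<in> stars I c S"
    then obtain i j where ij: "i \<in> I" "y = c i" "j \<in> I" "y \<in> S j"
      by (auto simp: stars_def)
    then have "i = j" using same_star[of i j y] by auto
    with ij c_notin show "(x, z) \<in> stars I c S" by auto
  qed
  moreover have "(x, x) \<notin> stars I c S" for x
    using c_notin by (auto simp: stars_def)
  ultimately show ?thesis by (simp add: acyclic_def)
qed

text \<open>A walk never leaves a star, because the stars are disjoint. Hence a component lies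
  within one star or is an isolated node.\<close>

lemma feasible_stars:
  assumes "\<And>i. i \<in> I \<Longrightarrow> card (S i) \<le> q"
  shows "pt_comp_feasible V q (stars I c S)"
proof -
  let ?A = "stars I c S"
  let ?R = "{(x, y). {x, y} \<in> skeleton ?A}"
  have reach: "w = v \<or> (\<exists>i\<in>I. v \<in> insert (c i) (S i) \<and> w \<in> insert (c i) (S i))"
    if "(v, w) \<in> ?R\<^sup>*" for v w
    using that
  proof (induction rule: rtrancl_induct)
    case (step y z)
    from step.hyps(2) have "{y, z} \<in> skeleton ?A" by simp
    then obtain j where j: "j \<in> I" "y \<in> insert (c j) (S j)" "z \<in> insert (c j) (S j)"
      by (cases rule: edge_cases) auto
    with step.IH same_star show ?case by metis
  qed simp
  have "card (?A \<inter> C \<times> C) \<le> q" if C: "C \<in> components V (skeleton ?A)" for C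
  proof -
    obtain v where v: "C = {w \<in> V. (v, w) \<in> ?R\<^sup>*}"
      using C unfolding components_def by blast
    show ?thesis
    proof (cases "\<exists>i\<in>I. v \<in> insert (c i) (S i)")
      case True
      then obtain i where i: "i \<in> I" "v \<in> insert (c i) (S i)" by blast
      have "C \<subseteq> insert (c i) (S i)"
        using reach same_star i v by blast
      then have "?A \<inter> C \<times> C \<subseteq> S i \<times> {c i}"
        using same_star i(1) by (fastforce simp: stars_def)
      moreover have "finite (S i)"
        using sub[OF i(1)] fin by (meson finite_insert finite_subset)
      ultimately have "card (?A \<inter> C \<times> C) \<le> card (S i \<times> {c i})"
        by (intro card_mono) auto
      with assms[OF i(1)] show ?thesis by (simp add: card_cartesian_product)
    next
      case False
      then have "C \<subseteq> {v}" using reach v by blast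
      then have "?A \<inter> C \<times> C = {}"
        using False by (auto simp: stars_def)
      then show ?thesis by simp
    qed
  qed
  then show ?thesis
    using fin sub acyclic_stars forest_stars
    by (auto simp: pt_comp_feasible_def polytree_def dag_def component_bounded_def stars_def)
qed

text \<open>Every node that is not a centre has the empty parent set and contributes 0.\<close>

lemma score_stars:
  assumes "\<And>i. i \<in> I \<Longrightarrow> S i \<in> F (c i)"
    and "\<And>v. v \<in> V \<Longrightarrow> {} \<in> F v" "\<And>v. v \<in> V \<Longrightarrow> f v {} = 0"
  shows "score V F f (stars I c S) = ereal (\<Sum>i\<in>I. f (c i) (S i))"
proof -
  let ?P = "parents (stars I c S)"
  have cV: "c ` I \<subseteq> V" using sub by auto
  have "local_score F f v (?P v) = ereal (f v (?P v))" if "v \<in> V" for v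
    using assms that parents_stars_centre parents_stars_other
    by (cases "v \<in> c ` I") (auto simp: local_score_def)
  then have "score V F f (stars I c S) = ereal (\<Sum>v\<in>V. f v (?P v))"
    by (simp add: score_def)
  also have "(\<Sum>v\<in>V. f v (?P v)) = (\<Sum>v\<in>c ` I. f v (?P v))"
    using fin cV assms(3) parents_stars_other by (intro sum.mono_neutral_right) auto
  also have "\<dots> = (\<Sum>i\<in>I. f (c i) (S i))"
    using inj_centre parents_stars_centre by (simp add: sum.reindex)
  finally show ?thesis .
qed

end

section \<open>Charging a feasible solution to dense stars\<close>

text \<open>If \<open>v\<close> or one of its parents is in \<open>N\<close>, then all arcs into
  \<open>v\<close> lie in the component of that node. At most \<open>card N\<close> components arise
  in this way, each with at most \<open>q\<close> arcs.\<close>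

lemma card_arcs_meeting_le:
  assumes fV: "finite V" and B: "B \<subseteq> V \<times> V" and bd: "component_bounded V q B"
    and N: "N \<subseteq> V" and T: "\<And>v. v \<in> T \<Longrightarrow> insert v (parents B v) \<inter> N \<noteq> {}" "T \<subseteq> V"
  shows "(\<Sum>v\<in>T. card (parents B v)) \<le> card N * q"
proof -
  let ?R = "{(x, y). {x, y} \<in> skeleton B}"
  define C where "C w = {x \<in> V. (w, x) \<in> ?R\<^sup>*}" for w
  have finB: "finite B" using B fV by (meson finite_SigmaI finite_subset)
  have finp: "finite (parents B v)" for v
    using finite_subset[OF _ fV, of "parents B v"] B by (auto simp: parents_def)
  have fT: "finite T" and fN: "finite N" using N T(2) fV finite_subset by auto
  have sub: "(\<Union>v\<in>T. parents B v \<times> {v}) \<subseteq> (\<Union>w\<in>N. B \<inter> C w \<times> C w)"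
  proof clarify
    fix u v assume uv: "v \<in> T" "u \<in> parents B v"
    have R: "(x, v) \<in> ?R" "(v, x) \<in> ?R" if "x \<in> parents B v" for x
      using that by (auto simp: skeleton_def parents_def insert_commute)
    obtain w where w: "w \<in> N" "w \<in> insert v (parents B v)" using T(1)[OF uv(1)] by blast
    have wv: "(w, v) \<in> ?R\<^sup>*" using w(2) R(1) by auto
    have "(w, u) \<in> ?R\<^sup>*" using wv R(2)[OF uv(2)] by (rule rtrancl_into_rtrancl)
    moreover have "(u, v) \<in> B" "u \<in> V" "v \<in> V" using uv B by (auto simp: parents_def)
    ultimately show "(u, v) \<in> (\<Union>w\<in>N. B \<inter> C w \<times> C w)"
      using w(1) wv by (auto simp: C_def)
  qed
  have "(\<Sum>v\<in>T. card (parents B v)) = card (\<Union>v\<in>T. parents B v \<times> {v})"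
    by (subst card_UN_disjoint) (auto simp: fT finp card_cartesian_product)
  also have "\<dots> \<le> card (\<Union>w\<in>N. B \<inter> C w \<times> C w)"
    using sub fN finB by (intro card_mono) auto
  also have "\<dots> \<le> (\<Sum>w\<in>N. card (B \<inter> C w \<times> C w))"
    by (rule card_UN_le[OF fN])
  also have "\<dots> \<le> (\<Sum>w\<in>N. q)"
  proof (rule sum_mono)
    fix w assume "w \<in> N"
    then have "C w \<in> components V (skeleton B)" using N by (auto simp: C_def components_def)
    then show "card (B \<inter> C w \<times> C w) \<le> q" using bd by (simp add: component_bounded_def)
  qed
  finally show ?thesis by simp
qed

text \<open>Justifies ignoring parent sets with more than \<open>q\<close> elements: no feasible
  solution contains one.\<close>

lemma card_parents_le:
  assumes "finite V" "B \<subseteq> V \<times> V" "component_bounded V q B" "v \<in> V"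
  shows "card (parents B v) \<le> q"
  using card_arcs_meeting_le[OF assms(1-3), of "{v}" "{v}"] assms(4) by simp

text \<open>The charging argument for any packing with property \<open>dom\<close>, however it was
  found. \<open>dom\<close> compares densities in cross-multiplied form.\<close>

lemma (in star_packing) score_le_dense_stars:
  assumes B: "pt_comp_feasible V q B" and sc: "score V F f B \<noteq> -\<infinity>"
    and zero: "\<And>v. v \<in> V \<Longrightarrow> f v {} = 0"
    and ne: "\<And>i. i \<in> I \<Longrightarrow> S i \<noteq> {}" and nonneg: "\<And>i. i \<in> I \<Longrightarrow> 0 \<le> f (c i) (S i)"
    and dom: "\<And>v T. v \<in> V \<Longrightarrow> T \<in> F v \<Longrightarrow> T \<noteq> {} \<Longrightarrow> card T \<le> q \<Longrightarrow> 0 < f v T \<Longrightarrow>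
      \<exists>i\<in>I. insert v T \<inter> insert (c i) (S i) \<noteq> {} \<and>
        f v T * real (card (S i)) \<le> f (c i) (S i) * real (card T)"
  shows "score V F f B \<le> ereal (2 * real q * (\<Sum>i\<in>I. f (c i) (S i)))"
proof -
  let ?P = "parents B"
  let ?N = "\<lambda>i. insert (c i) (S i)"
  have BV: "B \<subseteq> V \<times> V" and bd: "component_bounded V q B"
    using B by (auto simp: pt_comp_feasible_def polytree_def dag_def)
  \<comment> \<open>A single parent set outside \<open>F v\<close> would make the whole sum
    \<open>-\<infinity>\<close>, since no summand is \<open>\<infinity>\<close>.\<close>
  have mem: "?P v \<in> F v" if "v \<in> V" for v
  proof (rule ccontr)
    assume "?P v \<notin> F v"
    then have "local_score F f v (?P v) = -\<infinity>" by (simp add: local_score_def)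
    moreover have "(\<Sum>w\<in>V - {v}. local_score F f w (?P w)) \<noteq> \<infinity>"
      by (subst sum_Pinfty) (auto simp: local_score_def)
    ultimately have "score V F f B = -\<infinity>"
      using that fin by (simp add: score_def sum.remove)
    with sc show False by simp
  qed
  have finI: "finite I"
  proof (rule inj_on_finite[OF inj_centre _ fin])
    show "c ` I \<subseteq> V" using sub by auto
  qed
  define K where "K = {v \<in> V. 0 < f v (?P v)}"
  have KV: "K \<subseteq> V" and finK: "finite K" using fin by (auto simp: K_def)
  have "\<exists>i\<in>I. insert v (?P v) \<inter> ?N i \<noteq> {} \<and>
      f v (?P v) * real (card (S i)) \<le> f (c i) (S i) * real (card (?P v))" if "v \<in> K" for v
    using that zero card_parents_le[OF fin BV bd, of v] mem
    by (intro dom) (auto simp: K_def)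
  then have "\<exists>g. \<forall>v\<in>K. g v \<in> I \<and> insert v (?P v) \<inter> ?N (g v) \<noteq> {} \<and>
      f v (?P v) * real (card (S (g v))) \<le> f (c (g v)) (S (g v)) * real (card (?P v))"
    by (intro bchoice) blast
  then obtain g where g: "\<And>v. v \<in> K \<Longrightarrow> g v \<in> I"
    "\<And>v. v \<in> K \<Longrightarrow> insert v (?P v) \<inter> ?N (g v) \<noteq> {}"
    "\<And>v. v \<in> K \<Longrightarrow>
      f v (?P v) * real (card (S (g v))) \<le> f (c (g v)) (S (g v)) * real (card (?P v))"
    by blast
  have fS: "finite (S i)" if "i \<in> I" for i
    using sub[OF that] fin by (meson finite_insert finite_subset)
  have pos: "0 < card (S i)" if "i \<in> I" for i
    using fS ne that by (simp add: card_gt_0_iff)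
  have charge: "(\<Sum>v\<in>{v\<in>K. g v = i}. f v (?P v)) \<le> 2 * real q * f (c i) (S i)" if i: "i \<in> I" for i
  proof -
    let ?K = "{v\<in>K. g v = i}"
    let ?d = "f (c i) (S i) / real (card (S i))"
    have d: "0 \<le> ?d" using nonneg[OF i] by simp
    have "(\<Sum>v\<in>?K. card (?P v)) \<le> card (?N i) * q"
      using g(2) sub[OF i] KV by (intro card_arcs_meeting_le[OF fin BV bd]) auto
    \<comment> \<open>The star has \<open>card (S i) + 1\<close> nodes, and \<open>S i\<close> is
      nonempty. This is the source of the factor 2.\<close>
    also have "\<dots> \<le> (2 * card (S i)) * q"
      using c_notin[OF i] fS[OF i] pos[OF i] by (intro mult_right_mono) auto
    finally have le: "real (\<Sum>v\<in>?K. card (?P v)) \<le> real ((2 * card (S i)) * q)"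
      by (rule of_nat_mono)
    have "(\<Sum>v\<in>?K. f v (?P v)) \<le> (\<Sum>v\<in>?K. ?d * real (card (?P v)))"
      using g(3) pos[OF i] by (intro sum_mono) (auto simp: field_simps)
    also have "\<dots> = ?d * real (\<Sum>v\<in>?K. card (?P v))"
      by (simp add: sum_distrib_left)
    also have "\<dots> \<le> ?d * real ((2 * card (S i)) * q)"
      using le d by (rule mult_left_mono)
    also have "\<dots> = 2 * real q * f (c i) (S i)"
      using pos[OF i] by simp
    finally show ?thesis .
  qed
  have "score V F f B = ereal (\<Sum>v\<in>V. f v (?P v))"
    using mem by (simp add: score_def local_score_def)
  also have "(\<Sum>v\<in>V. f v (?P v)) \<le> (\<Sum>v\<in>V. if v \<in> K then f v (?P v) else 0)"
    by (rule sum_mono) (auto simp: K_def)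
  also have "\<dots> = (\<Sum>v\<in>K. f v (?P v))"
    using fin KV by (simp add: sum.inter_restrict[symmetric] Int_absorb1)
  also have "\<dots> = (\<Sum>i\<in>I. \<Sum>v\<in>{v\<in>K. g v = i}. f v (?P v))"
    using g(1) by (intro sum.group[symmetric] finK finI) auto
  also have "\<dots> \<le> (\<Sum>i\<in>I. 2 * real q * f (c i) (S i))"
    by (rule sum_mono) (rule charge)
  finally show ?thesis by (simp add: sum_distrib_left)
qed

section \<open>Total correctness with time bounds\<close>

definition runs :: "com \<Rightarrow> state \<Rightarrow> nat \<Rightarrow> (state \<Rightarrow> bool) \<Rightarrow> bool" where
  "runs c s T Q \<longleftrightarrow> (\<exists>t s'. exec c s t s' \<and> t \<le> T \<and> Q s')"

lemma runs_le: "runs c s T Q \<Longrightarrow> T \<le> T' \<Longrightarrow> runs c s T' Q"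
  unfolding runs_def by (meson le_trans)

lemma runs_post: "runs c s T (\<lambda>s'. s' = r) \<Longrightarrow> Q r \<Longrightarrow> runs c s T Q"
  unfolding runs_def by blast

lemma runs_Skip: "Q s \<Longrightarrow> runs Skip s 1 Q"
  unfolding runs_def using exec.Skip by blast

lemma runs_Store: "Q (upd (fst s) a (aval i s) (aval e s), snd s) \<Longrightarrow> runs (Store a i e) s 1 Q"
  unfolding runs_def using exec.Store by blast

lemma runs_RStore: "Q (fst s, upd (snd s) a (aval i s) (rval e s)) \<Longrightarrow> runs (RStore a i e) s 1 Q"
  unfolding runs_def using exec.RStore by blast

lemma runs_Seq:
  assumes "runs c1 s T1 R" "\<And>s'. R s' \<Longrightarrow> runs c2 s' T2 Q"
  shows "runs (Seq c1 c2) s (T1 + T2) Q"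
proof -
  obtain t1 s1 where 1: "exec c1 s t1 s1" "t1 \<le> T1" "R s1"
    using assms(1) by (auto simp: runs_def)
  obtain t2 s2 where 2: "exec c2 s1 t2 s2" "t2 \<le> T2" "Q s2"
    using assms(2)[OF 1(3)] by (auto simp: runs_def)
  show ?thesis
    unfolding runs_def using exec.Seq[OF 1(1) 2(1)] 1(2) 2(2,3) by (meson add_mono)
qed

lemma runs_Seq_eq:
  "runs c1 s T1 (\<lambda>s'. s' = r) \<Longrightarrow> runs c2 r T2 Q \<Longrightarrow> runs (Seq c1 c2) s (T1 + T2) Q"
  by (rule runs_Seq[where R = "\<lambda>s'. s' = r"]) auto

lemma runs_Seq_Store:
  "runs c (upd (fst s) a (aval i s) (aval e s), snd s) T Q \<Longrightarrow>
    runs (Seq (Store a i e) c) s (1 + T) Q"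
  by (rule runs_Seq_eq[OF runs_Store]) auto

lemma runs_Seq_RStore:
  "runs c (fst s, upd (snd s) a (aval i s) (rval e s)) T Q \<Longrightarrow>
    runs (Seq (RStore a i e) c) s (1 + T) Q"
  by (rule runs_Seq_eq[OF runs_RStore]) auto

text \<open>Adding the bounds of both branches instead of taking their maximum keeps time bounds
  free of case distinctions.\<close>

lemma runs_Cond:
  assumes "bval b s \<Longrightarrow> runs c1 s T1 Q" "\<not> bval b s \<Longrightarrow> runs c2 s T2 Q"
  shows "runs (Cond b c1 c2) s (1 + (T1 + T2)) Q"
proof (cases "bval b s")
  case True
  then obtain t s' where "exec c1 s t s'" "t \<le> T1" "Q s'" using assms(1) by (auto simp: runs_def)
  then show ?thesis
    unfolding runs_def using exec.CondTrue[OF True] by (intro exI[of _ "1 + t"] exI[of _ s']) auto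
next
  case False
  then obtain t s' where "exec c2 s t s'" "t \<le> T2" "Q s'" using assms(2) by (auto simp: runs_def)
  then show ?thesis
    unfolding runs_def using exec.CondFalse[OF False] by (intro exI[of _ "1 + t"] exI[of _ s']) auto
qed

text \<open>The invariant is indexed by the number of completed iterations. Each iteration pays one
  extra unit for its test, and the final test costs one more.\<close>

lemma runs_While:
  assumes init: "I 0 s"
    and step: "\<And>i s. i < n \<Longrightarrow> I i s \<Longrightarrow> bval b s \<and> runs c s T (I (Suc i))"
    and exit: "\<And>s. I n s \<Longrightarrow> \<not> bval b s \<and> Q s"
  shows "runs (While b c) s (n * (T + 1) + 1) Q"
proof -
  have "runs (While b c) s (k * (T + 1) + 1) Q" if "k \<le> n" "I (n - k) s" for k s
    using that
  proof (induction k arbitrary: s)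
    case 0
    then have "\<not> bval b s" "Q s" using exit by auto
    then show ?case
      unfolding runs_def
      by (intro exI[of _ 1] exI[of _ s]) (simp add: exec.WhileFalse[simplified])
  next
    case (Suc k)
    have "bval b s" "runs c s T (I (Suc (n - Suc k)))"
      using step[OF _ Suc.prems(2)] Suc.prems(1) by auto
    moreover have "Suc (n - Suc k) = n - k" using Suc.prems by simp
    ultimately obtain t1 s1 where 1: "bval b s" "exec c s t1 s1" "t1 \<le> T" "I (n - k) s1"
      by (auto simp: runs_def)
    then obtain t2 s2 where 2: "exec (While b c) s1 t2 s2" "t2 \<le> k * (T + 1) + 1" "Q s2"
      using Suc.IH[of s1] Suc.prems by (auto simp: runs_def)
    show ?case
      unfolding runs_def using exec.WhileTrue[OF 1(1,2) 2(1)] 1(3) 2(2,3)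
      by (intro exI[of _ "1 + t1 + t2"] exI[of _ s2]) auto
  qed
  from this[of n] init show ?thesis by simp
qed

lemma upd_same [simp]: "upd m a i x a = (m a)(i := x)"
  by (simp add: upd_def)

lemma upd_other [simp]: "b \<noteq> a \<Longrightarrow> upd m a i x b = m b"
  by (simp add: upd_def)

lemma upd_upd [simp]: "upd (upd m a i x) a i y = upd m a i y"
  by (simp add: upd_def)

lemma upd_swap: "a \<noteq> b \<Longrightarrow> upd (upd m a i x) b j y = upd (upd m b j y) a i x"
  by (simp add: upd_def fun_upd_twist)

section \<open>The greedy program\<close>

text \<open>Arrays named \<open>_var\<close> and \<open>_rvar\<close> serve as scalars, stored in
  cell 0. Natural and real arrays are numbered independently, and \<open>in_arr\<close> names the
  input array of both kinds.\<close>

abbreviation (input) "in_arr \<equiv> 0 :: nat"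
abbreviation (input) "out_arr \<equiv> 1 :: nat"
abbreviation (input) "mark_arr \<equiv> 2 :: nat"
abbreviation (input) "m_var \<equiv> 3 :: nat"
abbreviation (input) "round_var \<equiv> 4 :: nat"
abbreviation (input) "i_var \<equiv> 5 :: nat"
abbreviation (input) "pos_var \<equiv> 6 :: nat"
abbreviation (input) "len_var \<equiv> 7 :: nat"
abbreviation (input) "hit_var \<equiv> 8 :: nat"
abbreviation (input) "j_var \<equiv> 9 :: nat"
abbreviation (input) "best_len_var \<equiv> 10 :: nat"
abbreviation (input) "best_pos_var \<equiv> 11 :: nat"
abbreviation (input) "node_var \<equiv> 12 :: nat"
abbreviation (input) "best_rvar \<equiv> 1 :: nat"
abbreviation (input) "x_rvar \<equiv> 2 :: nat"
abbreviation (input) "lhs_rvar \<equiv> 3 :: nat"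
abbreviation (input) "rhs_rvar \<equiv> 4 :: nat"

abbreviation "Var a \<equiv> Cell a (Num 0)"
abbreviation "RVar a \<equiv> RCell a (Num 0)"
abbreviation "Set a e \<equiv> Store a (Num 0) e"
abbreviation "RSet a e \<equiv> RStore a (Num 0) e"
abbreviation "Inc a \<equiv> Set a (Add (Var a) (Num 1))"

definition scale :: "nat \<Rightarrow> nat \<Rightarrow> nat \<Rightarrow> com" where
  "scale d l w =
    Seq (Set j_var (Num 0))
    (Seq (RSet d RZero)
    (While (Less (Var j_var) (Var l))
      (Seq (RSet d (RAdd (RVar d) (RVar w)))
        (Inc j_var))))"

lemma runs_scale:
  assumes "l \<noteq> j_var" "w \<noteq> d"
  shows "runs (scale d l w) s (3 * fst s l 0 + 3)
    (\<lambda>s'. s' = (upd (fst s) j_var 0 (fst s l 0),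
                upd (snd s) d 0 (real (fst s l 0) * snd s w 0)))"
  unfolding scale_def
  apply (rule runs_le)
    apply (rule runs_Seq_Store runs_Seq_RStore)+
    apply (rule runs_While[where n = "fst s l 0" and T = "1 + 1" and I = "\<lambda>i s'.
        s' = (upd (fst s) j_var 0 i, upd (snd s) d 0 (real i * snd s w 0))"])
      apply simp
  subgoal
    apply (intro conjI)
    subgoal using assms by simp
    apply (rule runs_Seq_RStore runs_Store)+
    using assms by (simp add: algebra_simps)
  using assms by auto

text \<open>Marks are 0 or 1, so the sum vanishes exactly if the entry avoids all used nodes. An
  entry consists of its node, the number of parents and the parents, hence the offset 2.\<close>

definition count_hits :: com where
  "count_hits =
    Seq (Set hit_var (Cell mark_arr (Cell in_arr (Var pos_var))))
    (Seq (Set j_var (Num 0))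
    (While (Less (Var j_var) (Var len_var))
      (Seq (Set hit_var (Add (Var hit_var)
          (Cell mark_arr (Cell in_arr (Add (Add (Var pos_var) (Num 2)) (Var j_var))))))
        (Inc j_var))))"

lemma runs_count_hits:
  "runs count_hits s (3 * fst s len_var 0 + 3)
    (\<lambda>s'. s' = (upd (upd (fst s) j_var 0 (fst s len_var 0)) hit_var 0
        (fst s mark_arr (fst s in_arr (fst s pos_var 0)) +
          (\<Sum>j<fst s len_var 0. fst s mark_arr (fst s in_arr (fst s pos_var 0 + 2 + j)))), snd s))"
  unfolding count_hits_def
  apply (rule runs_le)
    apply (rule runs_Seq_Store runs_Seq_RStore)+
    apply (rule runs_While[where n = "fst s len_var 0" and T = "1 + 1" and I = "\<lambda>i s'.
        s' = (upd (upd (fst s) j_var 0 i) hit_var 0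
        (fst s mark_arr (fst s in_arr (fst s pos_var 0)) +
          (\<Sum>j<i. fst s mark_arr (fst s in_arr (fst s pos_var 0 + 2 + j)))), snd s)"])
      apply (simp add: upd_swap[of j_var hit_var])
  subgoal
    apply (intro conjI)
    subgoal by simp
    apply (rule runs_Seq_Store runs_Store)+
    by (simp add: upd_swap[of j_var hit_var] add.assoc)
  by auto

text \<open>The new entry is denser than the best one so far iff its score times the best size
  (\<open>rhs_rvar\<close>) exceeds the best score times its own size
  (\<open>lhs_rvar\<close>).\<close>

definition load_entry :: com where
  "load_entry =
    Seq (Set len_var (Cell in_arr (Add (Var pos_var) (Num 1))))
    (Seq (RSet x_rvar (RCell in_arr (Var i_var)))
    (Seq count_hits
    (Seq (scale lhs_rvar len_var best_rvar)
      (scale rhs_rvar best_len_var x_rvar))))"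

definition scan_step :: com where
  "scan_step =
    Seq load_entry
    (Seq (Cond (BAnd (BAnd (Less (Var hit_var) (Num 1)) (Less (Num 0) (Var len_var)))
               (BAnd (Less (Var len_var) (Add (Cell in_arr (Num 0)) (Num 1)))
                 (RLess (RVar lhs_rvar) (RVar rhs_rvar))))
      (Seq (Set best_pos_var (Var pos_var))
      (Seq (Set best_len_var (Var len_var))
        (RSet best_rvar (RVar x_rvar))))
      Skip)
    (Seq (Set pos_var (Add (Add (Var pos_var) (Num 2)) (Var len_var)))
      (Inc i_var)))"

definition pick_arc :: com where
  "pick_arc =
    Seq (Store mark_arr (Cell in_arr (Add (Add (Var best_pos_var) (Num 2)) (Var j_var))) (Num 1))
    (Seq (Store out_arr (Add (Add (Var out_arr) (Var out_arr)) (Num 1))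
        (Cell in_arr (Add (Add (Var best_pos_var) (Num 2)) (Var j_var))))
    (Seq (Store out_arr (Add (Add (Var out_arr) (Var out_arr)) (Num 2)) (Var node_var))
    (Seq (Inc out_arr)
      (Inc j_var))))"

definition pick :: com where
  "pick =
    Seq (Set node_var (Cell in_arr (Var best_pos_var)))
    (Seq (Store mark_arr (Var node_var) (Num 1))
    (Seq (Set len_var (Cell in_arr (Add (Var best_pos_var) (Num 1))))
    (Seq (Set j_var (Num 0))
    (While (Less (Var j_var) (Var len_var)) pick_arc))))"

definition greedy_round :: com where
  "greedy_round =
    Seq (Set i_var (Num 0))
    (Seq (Set pos_var (Add (Num 3) (Cell in_arr (Num 1))))
    (Seq (Set best_len_var (Num 1))
    (Seq (RSet best_rvar RZero)
    (Seq (While (Less (Var i_var) (Var m_var)) scan_step)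
    (Seq (Cond (RLess RZero (RVar best_rvar)) pick Skip)
      (Inc round_var))))))"

definition greedy_prog :: com where
  "greedy_prog =
    Seq (Set m_var (Cell in_arr (Add (Num 2) (Cell in_arr (Num 1)))))
      (While (Less (Var round_var) (Var m_var)) greedy_round)"

definition out_set :: "(nat \<Rightarrow> nat) \<Rightarrow> (nat \<times> nat) set" where
  "out_set h = {(h (2 * i + 1), h (2 * i + 2)) | i. i < h 0}"

text \<open>The memory update made by \<open>pick_arc\<close> appends one arc: the cells of earlier
  arcs lie below the two new ones.\<close>

lemma out_set_append:
  "out_set (h(Suc (h 0 + h 0) := a, Suc (Suc (h 0 + h 0)) := b, 0 := Suc (h 0))) =
    insert (a, b) (out_set h)"
proof -
  define h' where "h' = h(Suc (h 0 + h 0) := a, Suc (Suc (h 0 + h 0)) := b, 0 := Suc (h 0))"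
  have old: "h' (2 * i + 1) = h (2 * i + 1)" "h' (2 * i + 2) = h (2 * i + 2)" if "i < h 0" for i
  proof -
    have "2 * i + 1 \<noteq> Suc (h 0 + h 0)" "2 * i + 1 \<noteq> Suc (Suc (h 0 + h 0))"
      "2 * i + 2 \<noteq> Suc (h 0 + h 0)" "2 * i + 2 \<noteq> Suc (Suc (h 0 + h 0))"
      using that by arith+
    then show "h' (2 * i + 1) = h (2 * i + 1)" "h' (2 * i + 2) = h (2 * i + 2)"
      by (auto simp: h'_def)
  qed
  have new: "h' (2 * h 0 + 1) = a" "h' (2 * h 0 + 2) = b" "h' 0 = Suc (h 0)"
    by (simp_all add: h'_def mult_2)
  have "out_set h' = (\<lambda>i. (h' (2 * i + 1), h' (2 * i + 2))) ` {..<Suc (h 0)}"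
    using new by (auto simp: out_set_def)
  also have "\<dots> = insert (a, b) ((\<lambda>i. (h' (2 * i + 1), h' (2 * i + 2))) ` {..<h 0})"
    using new by (simp add: lessThan_Suc)
  also have "(\<lambda>i. (h' (2 * i + 1), h' (2 * i + 2))) ` {..<h 0} = out_set h"
    using old unfolding out_set_def by (force simp: image_iff)
  finally show ?thesis unfolding h'_def .
qed

section \<open>Correctness of the greedy program\<close>

locale presented_instance =
  fixes V :: "nat set" and q :: nat and F :: "nat \<Rightarrow> nat set set" and f :: "nat \<Rightarrow> nat set \<Rightarrow> real"
    and vs :: "nat list" and es :: "(nat \<times> nat list \<times> real) list"
  assumes inst: "pt_instance V F f" and pres: "presents vs es V F f"
begin

section \<open>Entries and their positions in the input array\<close>

definition node :: "nat \<Rightarrow> nat" where "node i = fst (es ! i)"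
definition pars :: "nat \<Rightarrow> nat list" where "pars i = fst (snd (es ! i))"
definition wt :: "nat \<Rightarrow> real" where "wt i = snd (snd (es ! i))"

abbreviation nodes :: "nat \<Rightarrow> nat set" where "nodes i \<equiv> insert (node i) (set (pars i))"
abbreviation len :: "nat \<Rightarrow> nat" where "len i \<equiv> length (pars i)"
abbreviation "N \<equiv> input_size q vs es"

lemma entry: "i < length es \<Longrightarrow> es ! i = (node i, pars i, wt i)"
  by (simp add: node_def pars_def wt_def)

lemma entry_facts:
  assumes "i < length es"
  shows "node i \<in> V" "set (pars i) \<in> F (node i)" "distinct (pars i)"
    "wt i = f (node i) (set (pars i))"
proof -
  have mem: "(node i, pars i, wt i) \<in> set es" using entry assms by (metis nth_mem)
  then have "(node i, set (pars i)) \<in> Sigma V F"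
    using pres unfolding presents_def by force
  then show "node i \<in> V" "set (pars i) \<in> F (node i)" by auto
  show "distinct (pars i)" "wt i = f (node i) (set (pars i))"
    using mem pres unfolding presents_def by blast+
qed

lemma entry_exists:
  assumes "v \<in> V" "T \<in> F v"
  obtains i where "i < length es" "node i = v" "set (pars i) = T"
proof -
  have "(v, T) \<in> set (map (\<lambda>(v, ps, x). (v, set ps)) es)"
    using assms pres unfolding presents_def by auto
  then obtain i where "i < length es" "(\<lambda>(v, ps, x). (v, set ps)) (es ! i) = (v, T)"
    by (auto simp: in_set_conv_nth)
  with entry that show ?thesis by simp
qed

lemma finite_V: "finite V"
  using inst by (simp add: pt_instance_def)

lemma nodes_sub: "i < length es \<Longrightarrow> nodes i \<subseteq> V"
  using entry_facts(1,2)[of i] inst unfolding pt_instance_def by blast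

lemma node_notin_pars: "i < length es \<Longrightarrow> node i \<notin> set (pars i)"
  using entry_facts(1,2)[of i] inst unfolding pt_instance_def by blast

definition enc :: "nat \<times> nat list \<times> real \<Rightarrow> nat list" where
  "enc = (\<lambda>(v, ps, x). [v, length ps] @ ps)"

text \<open>The 3 counts the cells holding \<open>q\<close>, \<open>length vs\<close> and
  \<open>length es\<close>.\<close>

definition pos :: "nat \<Rightarrow> nat" where
  "pos i = 3 + length vs + length (concat (map enc (take i es)))"

abbreviation "inp \<equiv> fst (initial_state q vs es) 0"
abbreviation "rinp \<equiv> snd (initial_state q vs es) 0"

lemma pos_0: "pos 0 = 3 + length vs"
  by (simp add: pos_def)

lemma pos_Suc: "i < length es \<Longrightarrow> pos (Suc i) = Suc (Suc (pos i + len i))"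
  by (simp add: pos_def take_Suc_conv_app_nth entry enc_def)

lemma nat_input_eq:
  "nat_input q vs es = [q, length vs] @ vs @ [length es] @ concat (map enc es)"
  by (simp add: nat_input_def enc_def)

lemma nat_input_split:
  assumes "i < length es"
  shows "nat_input q vs es = (([q, length vs] @ vs @ [length es]) @ concat (map enc (take i es))) @
    ([node i, len i] @ pars i) @ concat (map enc (drop (Suc i) es))"
proof -
  have "map enc es = map enc (take i es) @ enc (es ! i) # map enc (drop (Suc i) es)"
    using id_take_nth_drop[OF assms] by (metis list.simps(9) map_append)
  then show ?thesis
    using entry[OF assms] by (simp add: nat_input_eq enc_def)
qed

lemma inp_entry:
  assumes i: "i < length es" and k: "k < 2 + len i"
  shows "inp (pos i + k) = ([node i, len i] @ pars i) ! k"
proof -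
  let ?p = "([q, length vs] @ vs @ [length es]) @ concat (map enc (take i es))"
  have p: "length ?p = pos i" by (simp add: pos_def)
  have "pos i + k < length (nat_input q vs es)"
    unfolding nat_input_split[OF i] using k p by simp
  moreover have "nat_input q vs es ! (pos i + k) = ([node i, len i] @ pars i) ! k"
    unfolding nat_input_split[OF i] p[symmetric] nth_append_length_plus
    by (rule nth_append_left) (use k in simp)
  ultimately show ?thesis by (simp add: initial_state_def)
qed

text \<open>Through these rules the input accesses of the program turn into statements about
  entries.\<close>

lemma inp_simps [simp]:
  "inp 0 = q" "inp (Suc 0) = length vs" "inp (Suc (Suc (length vs))) = length es"
  "i < length es \<Longrightarrow> inp (pos i) = node i"
  "i < length es \<Longrightarrow> inp (Suc (pos i)) = len i"
  "i < length es \<Longrightarrow> j < len i \<Longrightarrow> inp (Suc (Suc (pos i + j))) = pars i ! j"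
  "i < length es \<Longrightarrow> rinp i = wt i"
  using inp_entry[of i 0] inp_entry[of i 1] inp_entry[of i "2 + j"]
  by (simp_all add: initial_state_def nat_input_def real_input_def entry nth_append)

lemma length_es_le: "length es \<le> N"
  by (simp add: input_size_def real_input_def)

lemma len_le:
  assumes "i < length es"
  shows "len i \<le> N"
  unfolding input_size_def nat_input_split[OF assms] by simp

section \<open>The greedy invariant\<close>

definition admissible :: "nat \<Rightarrow> bool" where
  "admissible i \<longleftrightarrow> i < length es \<and> 0 < len i \<and> len i \<le> q \<and> 0 < wt i"

definition eligible :: "nat set \<Rightarrow> nat \<Rightarrow> bool" where
  "eligible U i \<longleftrightarrow> admissible i \<and> nodes i \<inter> U = {}"

text \<open>The last conjunct is what greedy choice maintains. It is trivial for the empty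
  selection, and once nothing is eligible it becomes the property \<open>dom\<close> of the charging
  argument.\<close>

definition greedy :: "nat set \<Rightarrow> bool" where
  "greedy P \<longleftrightarrow> (\<forall>i\<in>P. admissible i) \<and>
     (\<forall>i\<in>P. \<forall>j\<in>P. i \<noteq> j \<longrightarrow> nodes i \<inter> nodes j = {}) \<and>
     (\<forall>k. admissible k \<longrightarrow> eligible (\<Union> (nodes ` P)) k \<or>
        (\<exists>i\<in>P. nodes k \<inter> nodes i \<noteq> {} \<and> wt k * real (len i) \<le> wt i * real (len k)))"

abbreviation arcs :: "nat set \<Rightarrow> (nat \<times> nat) set" where
  "arcs P \<equiv> stars P node (\<lambda>i. set (pars i))"

lemma greedy_empty: "greedy {}"
  by (simp add: greedy_def eligible_def)

text \<open>An entry that loses eligibility now must meet \<open>b\<close> and is dominated by it,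
  since \<open>b\<close> is densest. Entries lost earlier keep their dominating pick.\<close>

lemma greedy_insert:
  assumes P: "greedy P" and b: "eligible (\<Union> (nodes ` P)) b"
    and max: "\<And>k. eligible (\<Union> (nodes ` P)) k \<Longrightarrow> wt k * real (len b) \<le> wt b * real (len k)"
  shows "greedy (insert b P)" "b \<notin> P"
proof -
  have new: "nodes b \<inter> nodes i = {}" if "i \<in> P" for i
    using b that by (auto simp: eligible_def)
  then show "b \<notin> P" by blast
  have "eligible (\<Union> (nodes ` insert b P)) k \<or>
      (\<exists>i\<in>insert b P. nodes k \<inter> nodes i \<noteq> {} \<and> wt k * real (len i) \<le> wt i * real (len k))"
    if k: "admissible k" for k
  proof (cases "eligible (\<Union> (nodes ` P)) k")
    case True
    show ?thesis
    proof (cases "nodes k \<inter> nodes b = {}")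
      case True
      then show ?thesis using \<open>eligible (\<Union> (nodes ` P)) k\<close> by (auto simp: eligible_def)
    next
      case False
      then show ?thesis using max[OF \<open>eligible (\<Union> (nodes ` P)) k\<close>] by blast
    qed
  next
    case False
    then show ?thesis using P k unfolding greedy_def by blast
  qed
  moreover have "admissible i" if "i \<in> insert b P" for i
    using P b that by (auto simp: greedy_def eligible_def)
  moreover have "nodes i \<inter> nodes j = {}" if "i \<in> insert b P" "j \<in> insert b P" "i \<noteq> j" for i j
    using P new that unfolding greedy_def by blast
  ultimately show "greedy (insert b P)"
    unfolding greedy_def by blast
qed

lemma greedy_approximation:
  assumes P: "greedy P" and maximal: "\<And>k. \<not> eligible (\<Union> (nodes ` P)) k"
  shows "pt_comp_feasible V q (arcs P)"
    and "pt_comp_feasible V q B \<Longrightarrow> score V F f {} \<le> score V F f B \<Longrightarrow>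
      score V F f B \<le> ereal (2 * real q) * score V F f (arcs P)"
proof -
  have adm: "i < length es" "0 < len i" "len i \<le> q" "0 < wt i" if "i \<in> P" for i
    using P that by (auto simp: greedy_def admissible_def)
  have zero: "{} \<in> F v" "f v {} = 0" if "v \<in> V" for v
    using inst that by (auto simp: pt_instance_def)
  have card: "card (set (pars i)) = len i" if "i < length es" for i
    using entry_facts(3)[OF that] by (rule distinct_card)
  interpret star_packing V P node "\<lambda>i. set (pars i)"
  proof
    fix i j assume "i \<in> P" "j \<in> P" "i \<noteq> j"
    then show "nodes i \<inter> nodes j = {}" using P unfolding greedy_def by blast
  qed (use finite_V nodes_sub node_notin_pars adm(1) in auto)
  show "pt_comp_feasible V q (arcs P)"
    using adm card by (intro feasible_stars) auto
  have sc: "score V F f (arcs P) = ereal (\<Sum>i\<in>P. f (node i) (set (pars i)))"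
    using adm(1) entry_facts(2) zero by (intro score_stars) auto
  assume B: "pt_comp_feasible V q B" and "score V F f {} \<le> score V F f B"
  \<comment> \<open>The empty arc set has score 0, so a solution at least as good cannot score
    \<open>-\<infinity>\<close>.\<close>
  moreover have "score V F f {} = 0"
    using zero by (simp add: score_def local_score_def parents_def zero_ereal_def)
  ultimately have fin: "score V F f B \<noteq> -\<infinity>" by auto
  have "score V F f B \<le> ereal (2 * real q * (\<Sum>i\<in>P. f (node i) (set (pars i))))"
  proof (rule score_le_dense_stars[OF B fin])
    fix v T assume v: "v \<in> V" "T \<in> F v" "T \<noteq> {}" "card T \<le> q" "0 < f v T"
    obtain k where k: "k < length es" "node k = v" "set (pars k) = T"
      using entry_exists v(1,2) by blast
    have "admissible k"
      using k v card[OF k(1)] entry_facts(4)[OF k(1)] by (auto simp: admissible_def)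
    then obtain i where "i \<in> P" "nodes k \<inter> nodes i \<noteq> {}"
      "wt k * real (len i) \<le> wt i * real (len k)"
      using P maximal unfolding greedy_def by blast
    then show "\<exists>i\<in>P. insert v T \<inter> nodes i \<noteq> {} \<and>
        f v T * real (card (set (pars i))) \<le> f (node i) (set (pars i)) * real (card T)"
      using k adm(1) card entry_facts(4) by (intro bexI[of _ i]) auto
  next
    fix i assume "i \<in> P"
    then show "set (pars i) \<noteq> {}" "0 \<le> f (node i) (set (pars i))"
      using adm[of i] entry_facts(4)[of i] by auto
  qed (use zero in auto)
  then show "score V F f B \<le> ereal (2 * real q) * score V F f (arcs P)"
    using sc by simp
qed

text \<open>\<open>w\<close>, \<open>l\<close> and \<open>p\<close> are score, size and input position of a densest eligible entry among the
  first \<open>n\<close>. The value \<open>w = 0\<close> means that none was found, and then \<open>l\<close> is a positive dummy.\<close>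

definition best :: "nat set \<Rightarrow> nat \<Rightarrow> real \<Rightarrow> nat \<Rightarrow> nat \<Rightarrow> bool" where
  "best U n w l p \<longleftrightarrow> 0 < l \<and> l \<le> N \<and> 0 \<le> w \<and>
     (w = 0 \<or> (\<exists>k<n. eligible U k \<and> w = wt k \<and> l = len k \<and> p = pos k)) \<and>
     (\<forall>k<n. eligible U k \<longrightarrow> wt k * real l \<le> w * real (len k))"

lemma best_0: "best U 0 0 (Suc 0) p"
proof -
  \<comment> \<open>The dummy size 1 has to respect the bound \<open>N\<close>; the length fields
    alone make the input nonempty.\<close>
  have "0 < N" by (simp add: input_size_def nat_input_def)
  then show ?thesis by (simp add: best_def Suc_le_eq)
qed

lemma best_improve:
  assumes b: "best U n w l p" and n: "n < length es" and free: "nodes n \<inter> U = {}"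
    and "0 < len n" "len n \<le> q" and better: "real (len n) * w < real l * wt n"
  shows "best U (Suc n) (wt n) (len n) (pos n)"
proof -
  have l: "0 < real l" and w: "0 \<le> w" using b by (auto simp: best_def)
  have "0 \<le> real (len n) * w" using w by simp
  then have "0 < real l * wt n" using better by linarith
  then have pos: "0 < wt n" using l by (simp add: zero_less_mult_iff)
  have "wt k * real (len n) \<le> wt n * real (len k)" if k: "k < n" "eligible U k" for k
  proof -
    have "wt k * real l \<le> w * real (len k)" using b k by (auto simp: best_def)
    \<comment> \<open>Transitivity of the density order without division: pass through
      \<open>w\<close> and \<open>l\<close>, then cancel the positive factor
      \<open>l\<close>.\<close>
    then have "real (len n) * (wt k * real l) \<le> real (len n) * (w * real (len k))"
      by (intro mult_left_mono) auto
    also have "\<dots> = (real (len n) * w) * real (len k)" by simp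
    also have "\<dots> \<le> (real l * wt n) * real (len k)"
      using better by (intro mult_right_mono) auto
    finally have "real l * (wt k * real (len n)) \<le> real l * (wt n * real (len k))"
      by (simp add: algebra_simps)
    with l show ?thesis by simp
  qed
  with assms pos len_le show ?thesis
    by (auto simp: best_def eligible_def admissible_def less_Suc_eq)
qed

lemma best_keep:
  assumes b: "best U n w l p" and n: "n < length es"
    and worse: "eligible U n \<Longrightarrow> real l * wt n \<le> real (len n) * w"
  shows "best U (Suc n) w l p"
proof -
  have "\<exists>k<Suc n. eligible U k \<and> w = wt k \<and> l = len k \<and> p = pos k"
    if "\<exists>k<n. eligible U k \<and> w = wt k \<and> l = len k \<and> p = pos k"
    using that less_SucI by blast
  moreover have "wt k * real l \<le> w * real (len k)" if "k < Suc n" "eligible U k" for k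
    using that b worse by (auto simp: best_def less_Suc_eq mult.commute)
  ultimately show ?thesis using b unfolding best_def by blast
qed

section \<open>Loop invariants and running time\<close>

definition mem :: "nat set \<Rightarrow> (nat \<times> nat) set \<Rightarrow> nat \<Rightarrow> state \<Rightarrow> bool" where
  "mem U A r s \<longleftrightarrow> fst s in_arr = inp \<and> snd s in_arr = rinp \<and>
     fst s mark_arr = (\<lambda>x. if x \<in> U then 1 else 0) \<and> out_set (fst s out_arr) = A \<and>
     fst s m_var 0 = length es \<and> fst s round_var 0 = r"

definition scanned :: "nat set \<Rightarrow> (nat \<times> nat) set \<Rightarrow> nat \<Rightarrow> nat \<Rightarrow> state \<Rightarrow> bool" where
  "scanned U A r i s \<longleftrightarrow> mem U A r s \<and> fst s i_var 0 = i \<and> fst s pos_var 0 = pos i \<and>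
     best U i (snd s best_rvar 0) (fst s best_len_var 0) (fst s best_pos_var 0)"

lemma hits_eq_0:
  "((if node i \<in> U then 1 else 0) + (\<Sum>j<len i. if pars i ! j \<in> U then 1 else 0) = (0 :: nat)) \<longleftrightarrow>
    nodes i \<inter> U = {}"
  by (auto simp: in_set_conv_nth disjoint_iff)

text \<open>Three loops of at most \<open>N\<close> iterations take \<open>3 * N + 3\<close> units
  each, and two assignments are added. For the last loop the bound on the best size comes from
  \<open>best\<close>.\<close>

lemma runs_load_entry:
  assumes s: "scanned U A r i s" and i: "i < length es"
  shows "runs load_entry s (9 * N + 11) (\<lambda>s'. scanned U A r i s' \<and>
    fst s' len_var 0 = len i \<and> snd s' x_rvar 0 = wt i \<and>
    (fst s' hit_var 0 = 0 \<longleftrightarrow> nodes i \<inter> U = {}) \<and>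
    snd s' lhs_rvar 0 = real (len i) * snd s' best_rvar 0 \<and>
    snd s' rhs_rvar 0 = real (fst s' best_len_var 0) * wt i)"
proof -
  note m = s[unfolded scanned_def mem_def]
  have l: "fst s best_len_var 0 \<le> N" using s by (simp add: scanned_def best_def)
  have hits: "(\<Sum>j<len i. if inp (Suc (Suc (pos i + j))) \<in> U then 1 else 0) =
      (\<Sum>j<len i. if pars i ! j \<in> U then 1 else (0 :: nat))"
    using i by (intro sum.cong) auto
  show ?thesis
    unfolding load_entry_def
    apply (rule runs_le)
     apply (rule runs_Seq_Store)
     apply (rule runs_Seq_RStore)
     apply (rule runs_Seq_eq, rule runs_count_hits)
     apply (rule runs_Seq_eq, rule runs_scale, simp, simp)
     apply (rule runs_post, rule runs_scale, simp, simp)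
    subgoal
      using m i by (simp add: scanned_def mem_def hits hits_eq_0[simplified])
    using m i l len_le[OF i] by simp
qed

lemma runs_scan_step:
  assumes s: "scanned U A r i s" and i: "i < length es"
  shows "runs scan_step s (9 * N + 18) (scanned U A r (Suc i))"
  unfolding scan_step_def
  apply (rule runs_le)
   apply (rule runs_Seq, rule runs_load_entry[OF s i])
   \<comment> \<open>Between the test and the increments, \<open>best\<close> already covers entry
     \<open>i\<close> while position and counter still refer to it.\<close>
   apply (rule runs_Seq[where R = "\<lambda>s'. mem U A r s' \<and> fst s' i_var 0 = i \<and>
        fst s' pos_var 0 = pos i \<and> fst s' len_var 0 = len i \<and>
        best U (Suc i) (snd s' best_rvar 0) (fst s' best_len_var 0) (fst s' best_pos_var 0)"])
    apply (rule runs_Cond)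
     apply (rule runs_Seq_Store)
     apply (rule runs_Seq_Store)
     apply (rule runs_RStore)
  subgoal for s'
    using i best_improve[of U i "snd s' best_rvar 0" "fst s' best_len_var 0" "fst s' best_pos_var 0"]
    by (simp add: scanned_def mem_def)
    apply (rule runs_Skip)
  subgoal for s'
    using i best_keep[of U i "snd s' best_rvar 0" "fst s' best_len_var 0" "fst s' best_pos_var 0"]
    by (auto simp add: scanned_def mem_def eligible_def admissible_def not_less)
   apply (rule runs_Seq_Store)
   apply (rule runs_Store)
  subgoal using i by (simp add: scanned_def mem_def pos_Suc)
  by simp

lemma runs_pick:
  assumes s: "mem U A r s" and k: "k < length es" "fst s best_pos_var 0 = pos k"
  shows "runs pick s (6 * N + 5) (mem (nodes k \<union> U) (set (pars k) \<times> {node k} \<union> A) r)"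
proof -
  \<comment> \<open>After \<open>j\<close> iterations the centre and the first \<open>j\<close>
    parents are marked and the first \<open>j\<close> arcs are written.\<close>
  let ?I = "\<lambda>j s'. mem (insert (node k) (set (take j (pars k)) \<union> U))
        (set (take j (pars k)) \<times> {node k} \<union> A) r s' \<and>
      fst s' best_pos_var 0 = pos k \<and> fst s' node_var 0 = node k \<and> fst s' len_var 0 = len k \<and>
      fst s' j_var 0 = j"
  have step: "runs pick_arc s' 5 (?I (Suc j))" if j: "j < len k" and I: "?I j s'" for j s'
  proof -
    have mark: "insert (node k) (set (take (Suc j) (pars k)) \<union> U) =
        insert (pars k ! j) (insert (node k) (set (take j (pars k)) \<union> U))"
      and out: "set (take (Suc j) (pars k)) \<times> {node k} \<union> A =
        insert (pars k ! j, node k) (set (take j (pars k)) \<times> {node k} \<union> A)"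
      using j by (auto simp: take_Suc_conv_app_nth)
    show ?thesis
      unfolding mark out pick_arc_def
      apply (rule runs_le)
       apply (rule runs_Seq_Store)+
       apply (rule runs_Store)
      subgoal using I j k(1) by (auto simp: mem_def out_set_append[unfolded fun_upd_def] fun_upd_def)
      by simp
  qed
  show ?thesis
    unfolding pick_def
    apply (rule runs_le)
     apply (rule runs_Seq_Store)+
     apply (rule runs_While[where n = "len k" and T = 5 and I = ?I])
    subgoal using s k by (auto simp: mem_def fun_eq_iff)
    subgoal for j s' using step[of j s'] by simp
    subgoal by simp
    using len_le[OF k(1)] by simp
qed

text \<open>A round that picks nothing ends the search; otherwise the number of picks equals the number of
  rounds, and after \<open>length es\<close> rounds every entry has been picked.\<close>

definition round_inv :: "nat \<Rightarrow> state \<Rightarrow> bool" where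
  "round_inv r s \<longleftrightarrow> (\<exists>P. greedy P \<and> mem (\<Union> (nodes ` P)) (arcs P) r s \<and>
     (card P = r \<or> (\<forall>k. \<not> eligible (\<Union> (nodes ` P)) k)))"

lemma greedy_finite: "greedy P \<Longrightarrow> P \<subseteq> {..<length es}" "greedy P \<Longrightarrow> finite P"
proof -
  show "P \<subseteq> {..<length es}" if "greedy P"
    using that by (auto simp: greedy_def admissible_def)
  then show "finite P" if "greedy P"
    using that finite_subset by blast
qed

lemma runs_greedy_round:
  assumes "round_inv r s"
  shows "runs greedy_round s (N * (9 * N + 19) + 6 * N + 14) (round_inv (Suc r))"
proof -
  obtain P where P: "greedy P" and m: "mem (\<Union> (nodes ` P)) (arcs P) r s"
    and c: "card P = r \<or> (\<forall>k. \<not> eligible (\<Union> (nodes ` P)) k)"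
    using assms by (auto simp: round_inv_def)
  let ?U = "\<Union> (nodes ` P)"
  \<comment> \<open>The state before the round counter is incremented: the selection may have grown,
    but the counter still holds \<open>r\<close>.\<close>
  let ?R = "\<lambda>s'. \<exists>P. greedy P \<and> mem (\<Union> (nodes ` P)) (arcs P) r s' \<and>
     (card P = Suc r \<or> (\<forall>k. \<not> eligible (\<Union> (nodes ` P)) k))"
  have scan: "runs (While (Less (Var i_var) (Var m_var)) scan_step) s'
      (length es * (9 * N + 18 + 1) + 1) (scanned ?U (arcs P) r (length es))"
    if "scanned ?U (arcs P) r 0 s'" for s'
  proof (rule runs_While[where I = "scanned ?U (arcs P) r"])
    fix i s' assume "i < length es" "scanned ?U (arcs P) r i s'"
    then show "bval (Less (Var i_var) (Var m_var)) s' \<and>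
        runs scan_step s' (9 * N + 18) (scanned ?U (arcs P) r (Suc i))"
      by (simp add: runs_scan_step) (simp add: scanned_def mem_def)
  next
    fix s' assume "scanned ?U (arcs P) r (length es) s'"
    then show "\<not> bval (Less (Var i_var) (Var m_var)) s' \<and> scanned ?U (arcs P) r (length es) s'"
      by (simp add: scanned_def mem_def)
  qed (rule that)
  have pick: "runs pick s' (6 * N + 5) ?R"
    if sc: "scanned ?U (arcs P) r (length es) s'" and pos: "0 < snd s' best_rvar 0" for s'
  proof -
    \<comment> \<open>A positive best score excludes the dummy, so a densest eligible entry has been
      stored.\<close>
    obtain b where b: "b < length es" "eligible ?U b" "fst s' best_pos_var 0 = pos b"
      "\<And>k. eligible ?U k \<Longrightarrow> wt k * real (len b) \<le> wt b * real (len k)"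
      using sc pos by (auto simp: scanned_def best_def eligible_def admissible_def)
    note ins = greedy_insert[OF P b(2,4)]
    \<comment> \<open>Eligibility of \<open>b\<close> rules out that the search had already ended,
      so \<open>card P = r\<close>.\<close>
    have "card (insert b P) = Suc r"
      using c b(2) ins(2) greedy_finite(2)[OF P] by auto
    moreover have "nodes b \<union> ?U = \<Union> (nodes ` insert b P)"
      "set (pars b) \<times> {node b} \<union> arcs P = arcs (insert b P)"
      by (auto simp: stars_def)
    ultimately have post: "?R s''"
      if "mem (nodes b \<union> ?U) (set (pars b) \<times> {node b} \<union> arcs P) r s''" for s''
      using that ins(1) by (intro exI[of _ "insert b P"]) simp
    have "runs pick s' (6 * N + 5) (mem (nodes b \<union> ?U) (set (pars b) \<times> {node b} \<union> arcs P) r)"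
      using sc b by (intro runs_pick) (auto simp: scanned_def)
    then show ?thesis using post unfolding runs_def by blast
  qed
  have skip: "?R s'"
    if sc: "scanned ?U (arcs P) r (length es) s'" and pos: "\<not> 0 < snd s' best_rvar 0" for s'
  proof -
    have "\<not> eligible ?U k" for k
    proof
      assume k: "eligible ?U k"
      have w: "snd s' best_rvar 0 = 0" and l: "0 < fst s' best_len_var 0"
        using sc pos by (auto simp: scanned_def best_def)
      \<comment> \<open>With best score 0, maximality forces this product of two positive numbers to
        be nonpositive.\<close>
      have "wt k * real (fst s' best_len_var 0) \<le> 0"
        using sc k w by (auto simp: scanned_def best_def eligible_def admissible_def)
      moreover have "0 < wt k" using k by (simp add: eligible_def admissible_def)
      ultimately show False using l by (simp add: mult_le_0_iff)
    qed
    then show ?thesis using P sc by (auto simp: scanned_def)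
  qed
  have le: "length es * (9 * N + 19) \<le> N * (9 * N + 19)"
    using length_es_le by (rule mult_right_mono) simp
  show ?thesis
    unfolding greedy_round_def
    apply (rule runs_le)
     apply (rule runs_Seq_Store)
     apply (rule runs_Seq_Store)
     apply (rule runs_Seq_Store)
     apply (rule runs_Seq_RStore)
     apply (rule runs_Seq)
      apply (rule scan)
    subgoal using m by (simp add: scanned_def mem_def pos_0 best_0)
     apply (rule runs_Seq[where R = ?R])
      apply (rule runs_Cond)
       apply (rule pick)
        apply assumption
    subgoal by simp
      apply (rule runs_Skip)
    subgoal using skip by simp
     apply (rule runs_Store)
    subgoal by (simp add: round_inv_def mem_def)
    using le by (simp add: algebra_simps)
qed

lemma runs_greedy_prog:
  "runs greedy_prog (initial_state q vs es) (N * (N * (9 * N + 19) + 6 * N + 15) + 2)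
    (\<lambda>s. \<exists>P. greedy P \<and> output_arcs s = arcs P \<and> (\<forall>k. \<not> eligible (\<Union> (nodes ` P)) k))"
proof -
  have init: "round_inv 0 (upd (fst (initial_state q vs es)) m_var 0 (length es),
      snd (initial_state q vs es))"
    unfolding round_inv_def
    by (rule exI[of _ "{}"])
      (auto simp: greedy_empty mem_def stars_def out_set_def initial_state_def fun_eq_iff)
  have exit: "\<exists>P. greedy P \<and> output_arcs s = arcs P \<and> (\<forall>k. \<not> eligible (\<Union> (nodes ` P)) k)"
    if inv: "round_inv (length es) s" for s
  proof -
    obtain P where P: "greedy P" and m: "mem (\<Union> (nodes ` P)) (arcs P) (length es) s"
      and c: "card P = length es \<or> (\<forall>k. \<not> eligible (\<Union> (nodes ` P)) k)"
      using inv by (auto simp: round_inv_def)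
    have "\<not> eligible (\<Union> (nodes ` P)) k" for k
    proof (cases "card P = length es")
      case True
      \<comment> \<open>Once all entries are picked, none is eligible, since each meets its own
        nodes.\<close>
      then have "P = {..<length es}"
        using greedy_finite(1)[OF P] by (intro card_subset_eq) auto
      then show ?thesis by (auto simp: eligible_def admissible_def)
    qed (use c in auto)
    moreover have "output_arcs s = arcs P"
      using m by (simp add: mem_def out_set_def output_arcs_def)
    ultimately show ?thesis using P by blast
  qed
  have le: "length es * (N * (9 * N + 19) + 6 * N + 15) \<le> N * (N * (9 * N + 19) + 6 * N + 15)"
    using length_es_le by (rule mult_right_mono) simp
  show ?thesis
    unfolding greedy_prog_def
    apply (rule runs_le)
     apply (rule runs_Seq_Store)
     apply (rule runs_While[where I = round_inv and n = "length es"
          and T = "N * (9 * N + 19) + 6 * N + 14"])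
    subgoal using init by simp
    subgoal for i s using runs_greedy_round[of i s] by (auto simp: round_inv_def mem_def)
    subgoal for s using exit[of s] by (auto simp: round_inv_def mem_def)
    using le by (simp add: algebra_simps)
qed

end

theorem theorem4p3:
  shows "\<exists>(c :: com) (p :: nat poly).
    \<forall>(V :: nat set) (q :: nat) (F :: nat \<Rightarrow> nat set set) (f :: nat \<Rightarrow> nat set \<Rightarrow> real) vs es.
      pt_instance V F f \<longrightarrow> presents vs es V F f \<longrightarrow>
      (\<exists>t s D. exec c (initial_state q vs es) t s \<and> t \<le> poly p (input_size q vs es) \<and>
         D = output_arcs s \<and> pt_comp_feasible V q D \<and>
         (\<forall>D\<^sub>o\<^sub>p\<^sub>t. pt_comp_optimal V q F f D\<^sub>o\<^sub>p\<^sub>t \<longrightarrow>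
            score V F f D \<le> score V F f D\<^sub>o\<^sub>p\<^sub>t \<and>
            score V F f D\<^sub>o\<^sub>p\<^sub>t \<le> ereal (2 * real q) * score V F f D))"
proof (rule exI[of _ greedy_prog], rule exI[of _ "[:2, 15, 25, 9:]"], intro allI impI)
  fix V F f vs es and q :: nat
  assume "pt_instance V F f" "presents vs es V F f"
  then interpret presented_instance V q F f vs es by unfold_locales
  obtain t s P where run: "exec greedy_prog (initial_state q vs es) t s"
    "t \<le> N * (N * (9 * N + 19) + 6 * N + 15) + 2"
    and P: "greedy P" "output_arcs s = arcs P" "\<And>k. \<not> eligible (\<Union> (nodes ` P)) k"
    using runs_greedy_prog unfolding runs_def by blast
  note approx = greedy_approximation[OF P(1,3)]
  \<comment> \<open>The coefficients come from expanding the bound in \<open>run(2)\<close>, lowest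
    degree first.\<close>
  have "t \<le> poly [:2, 15, 25, 9:] N"
    using run(2) by (simp add: algebra_simps)
  moreover have "score V F f (arcs P) \<le> score V F f D\<^sub>o\<^sub>p\<^sub>t \<and>
      score V F f D\<^sub>o\<^sub>p\<^sub>t \<le> ereal (2 * real q) * score V F f (arcs P)"
    if opt: "pt_comp_optimal V q F f D\<^sub>o\<^sub>p\<^sub>t" for D\<^sub>o\<^sub>p\<^sub>t
  proof -
    \<comment> \<open>The empty packing shows that \<open>{}\<close> is feasible, so an optimum
      scores at least as much as \<open>{}\<close>.\<close>
    interpret empty: star_packing V "{} :: nat set" node "\<lambda>i. set (pars i)"
      using finite_V by unfold_locales auto
    have "pt_comp_feasible V q {}"
      using empty.feasible_stars[of q] by (simp add: stars_def)
    then show ?thesis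
      using opt approx unfolding pt_comp_optimal_def by blast
  qed
  ultimately show "\<exists>t s D. exec greedy_prog (initial_state q vs es) t s \<and>
      t \<le> poly [:2, 15, 25, 9:] (input_size q vs es) \<and>
      D = output_arcs s \<and> pt_comp_feasible V q D \<and>
      (\<forall>D\<^sub>o\<^sub>p\<^sub>t. pt_comp_optimal V q F f D\<^sub>o\<^sub>p\<^sub>t \<longrightarrow>
         score V F f D \<le> score V F f D\<^sub>o\<^sub>p\<^sub>t \<and>
         score V F f D\<^sub>o\<^sub>p\<^sub>t \<le> ereal (2 * real q) * score V F f D)"
    using run(1) P(2) approx(1) by (intro exI[of _ t] exI[of _ s]) simp
qed

end
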